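(* Let $I=[0,1]$. Let $a\in(1,\infty)$ be an irrational number such that $a^k$ is irrational for every positive integer $k$, and let $b\in(0,1)$ be a rational number such that $\frac1a>b$. Let $$H_{a,b}=\Big\{(x,y)\in I\times I : y=ax,\ x\in\Big[\tfrac{b}{a^2},\tfrac1a\Big]\Big\}\cup\Big\{(x,y)\in I\times I : y=bx,\ x\in\Big[\tfrac1{a^2},1\Big]\Big\}$$ and $$H=H_{a,b}\cup\Big(\Big[0,\tfrac{b}{a^2}\Big]\times\Big\{\tfrac ba\Big\}\Big)\subseteq I\times I.$$ Then 1. $H$ is the graph of an upper semicontinuous set-valued function from $I$ to $I$; 2. $H$ is i-embedded into $I\times I$; that is, $\mathrm{ent}(H)>0$ and no periodic point is generated by $H$.
   Context: For compact metric spaces $X,Y$, $2^Y$ is the set of nonempty closed subsets of $Y$; a set-valued function from $X$ to $Y$ is a function $F:X\to 2^Y$, with graph $\Gamma(F)=\{(x,y)\in X\times Y : y\in F(x)\}$. $F$ is upper semicontinuous if for each $x_0\in X$ and each open $U\subseteq Y$ with $F(x_0)\subseteq U$ there is an open $V\ni x_0$ with $F(x)\subseteq U$ for all $x\in V$. A closed relation on a compact metric space $X$ is a closed subset $G\subseteq X\times X$. For a positive integer $m$, $\star_{i=1}^{m}G^{-1}=\{(x_1,\dots,x_{m+1})\in X^{m+1} : (x_{i+1},x_i)\in G \text{ for } i=1,\dots,m\}$, and $\star_{i=1}^{\infty}G^{-1}=\{(x_1,x_2,\dots)\in\prod_{i=1}^\infty X : (x_{i+1},x_i)\in G\text{ for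 all }i\ge1\}$. The shift map $\sigma$ on $\star_{i=1}^{\infty}G^{-1}$ is $\sigma(x_1,x_2,x_3,\dots)=(x_2,x_3,\dots)$. A periodic point generated by $G$ is a point $\mathbf x\in\star_{i=1}^{\infty}G^{-1}$ with $\sigma^n(\mathbf x)=\mathbf x$ for some positive integer $n$; no periodic point is generated by $G$ if there is no such $\mathbf x$. For an open cover $\alpha$ of $X$, $\alpha^{n}=\{A_1\times\dots\times A_n : A_j\in\alpha\}$, and for closed $K\subseteq X^n$, $N(K,\alpha^n)$ is the minimal cardinality of a subfamily of $\alpha^n$ whose union contains $K$. For $G\ne\emptyset$, $\mathrm{ent}(G,\alpha)=\lim_{m\to\infty}\frac{1}{m}\log N(\star_{i=1}^mG^{-1},\alpha^{m+1})$ (convention: $\log 0:=0$, relevant only if a Mahavier product is empty; the limit exists). The entropy is $\mathrm{ent}(G)=\sup_\alpha\mathrm{ent}(G,\alpha)\in[0,\infty]$ over all open covers $\alpha$ of $X$ if $G\neq\emptyset$, and $\mathrm{ent}(\emptyset)=0$. $G$ is i-embedded (irrationally embedded) into $X\times X$ if $\mathrm{ent}(G)>0$ and no periodic point is generated by $G$. *)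

theory Defs
  imports "HOL-Analysis.Analysis"
begin

text \<open>
  The compact metric spaces are given by carrier sets \<open>X\<close>, \<open>Y\<close> inside metric types; ``open'' and
  ``closed'' are meant relative to the carrier.  Coordinates of tuples and sequences are counted
  from 0: a point of \<open>X\<^sup>n\<close> is an extensional function on \<open>{..<n}\<close>, and \<open>x i\<close> stands for the
  coordinate with number \<open>i + 1\<close> in 1-based notation.
\<close>

subsection \<open>Set-valued functions\<close>

definition hyperspace :: "'a::metric_space set \<Rightarrow> 'a set set" where
  "hyperspace Y = {K. K \<noteq> {} \<and> closedin (top_of_set Y) K}"

definition set_valued_graph ::
    "'a::metric_space set \<Rightarrow> 'b::metric_space set \<Rightarrow> ('a \<Rightarrow> 'b set) \<Rightarrow> ('a \<times> 'b) set" where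
  "set_valued_graph X Y F = {(x, y) \<in> X \<times> Y. y \<in> F x}"

definition upper_semicontinuous ::
    "'a::metric_space set \<Rightarrow> 'b::metric_space set \<Rightarrow> ('a \<Rightarrow> 'b set) \<Rightarrow> bool" where
  "upper_semicontinuous X Y F \<longleftrightarrow>
     (\<forall>x0 \<in> X. \<forall>U. openin (top_of_set Y) U \<and> F x0 \<subseteq> U \<longrightarrow>
        (\<exists>V. openin (top_of_set X) V \<and> x0 \<in> V \<and> (\<forall>x \<in> V. F x \<subseteq> U)))"

subsection \<open>Closed relations and Mahavier products\<close>

definition closed_relation :: "'a::metric_space set \<Rightarrow> 'a rel \<Rightarrow> bool" where
  "closed_relation X G \<longleftrightarrow> closedin (top_of_set (X \<times> X)) G"

definition mahavier_product :: "'a::metric_space set \<Rightarrow> 'a rel \<Rightarrow> nat \<Rightarrow> (nat \<Rightarrow> 'a) set" where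
  "mahavier_product X G m =
     {x \<in> {..<m + 1} \<rightarrow>\<^sub>E X. \<forall>i < m. (x (i + 1), x i) \<in> G}"

definition inf_mahavier_product :: "'a::metric_space set \<Rightarrow> 'a rel \<Rightarrow> (nat \<Rightarrow> 'a) set" where
  "inf_mahavier_product X G = {x. (\<forall>i. x i \<in> X) \<and> (\<forall>i. (x (i + 1), x i) \<in> G)}"

definition shift_map :: "(nat \<Rightarrow> 'a) \<Rightarrow> (nat \<Rightarrow> 'a)" where
  "shift_map x = (\<lambda>i. x (i + 1))"

definition periodic_point :: "'a::metric_space set \<Rightarrow> 'a rel \<Rightarrow> (nat \<Rightarrow> 'a) \<Rightarrow> bool" where
  "periodic_point X G x \<longleftrightarrow>
     x \<in> inf_mahavier_product X G \<and> (\<exists>n \<ge> 1. (shift_map ^^ n) x = x)"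

subsection \<open>Entropy\<close>

definition open_cover :: "'a::metric_space set \<Rightarrow> 'a set set \<Rightarrow> bool" where
  "open_cover X \<alpha> \<longleftrightarrow> (\<forall>A \<in> \<alpha>. openin (top_of_set X) A) \<and> \<Union>\<alpha> = X"

definition cover_power :: "'a set set \<Rightarrow> nat \<Rightarrow> (nat \<Rightarrow> 'a) set set" where
  "cover_power \<alpha> n = {Pi\<^sub>E {..<n} A | A. \<forall>j < n. A j \<in> \<alpha>}"

text \<open>Over a compact carrier, a closed \<open>K \<subseteq> X\<^sup>n\<close> has a finite subcover, so minimising over
  finite subfamilies is no restriction; \<open>card\<close> is 0 on infinite families, which must therefore
  be excluded.\<close>

definition cover_number :: "'b set \<Rightarrow> 'b set set \<Rightarrow> nat" where
  "cover_number K \<B> = (LEAST k. \<exists>\<S> \<subseteq> \<B>. finite \<S> \<and> K \<subseteq> \<Union>\<S> \<and> card \<S> = k)"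

text \<open>The convention \<open>log 0 = 0\<close> (for empty Mahavier products) is the one of \<^const>\<open>ln\<close>, and the
  junk value at \<open>m = 0\<close> is irrelevant to the limit.\<close>

definition cover_entropy :: "'a::metric_space set \<Rightarrow> 'a rel \<Rightarrow> 'a set set \<Rightarrow> real" where
  "cover_entropy X G \<alpha> =
     lim (\<lambda>m. 1 / real m *
       ln (real (cover_number (mahavier_product X G m) (cover_power \<alpha> (m + 1)))))"

definition entropy :: "'a::metric_space set \<Rightarrow> 'a rel \<Rightarrow> ereal" where
  "entropy X G =
     (if G = {} then 0 else (SUP \<alpha> \<in> {\<alpha>. open_cover X \<alpha>}. ereal (cover_entropy X G \<alpha>)))"

definition i_embedded :: "'a::metric_space set \<Rightarrow> 'a rel \<Rightarrow> bool" where
  "i_embedded X G \<longleftrightarrow>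
     closed_relation X G \<and> entropy X G > 0 \<and> \<not> (\<exists>x. periodic_point X G x)"

subsection \<open>The relation \<open>H\<close>\<close>

definition H_ab :: "real \<Rightarrow> real \<Rightarrow> real rel" where
  "H_ab a b =
     {(x, y) \<in> {0..1} \<times> {0..1}. y = a * x \<and> x \<in> {b / a\<^sup>2 .. 1 / a}} \<union>
     {(x, y) \<in> {0..1} \<times> {0..1}. y = b * x \<and> x \<in> {1 / a\<^sup>2 .. 1}}"

definition H_rel :: "real \<Rightarrow> real \<Rightarrow> real rel" where
  "H_rel a b = H_ab a b \<union> {0 .. b / a\<^sup>2} \<times> {b / a}"

end

theory Submission
  imports Defs
begin

text \<open>
  Every value of the relation is at least \<open>b / a\<^sup>2\<close>, so a point that is itself a value can meet
  the horizontal segment only over its right end point, which also lies on the branch \<open>y = a x\<close>.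
  Along a periodic point every step is therefore a multiplication by \<open>a\<close> or by \<open>b\<close>, and closing up means
  \<open>a\<^sup>k b\<^sup>l = 1\<close> with \<open>k + l \<ge> 1\<close>.  This is impossible: for \<open>k \<ge> 1\<close> it makes \<open>a\<^sup>k\<close> rational, and
  for \<open>k = 0\<close> it contradicts \<open>b < 1\<close> (lemma \<open>H_rel_no_periodic_point\<close>).

  Positive entropy comes from the core \<open>[1/a\<^sup>2, 1/a]\<close>, on which both branches are defined.  Since
  multiplications commute, a core point \<open>x\<close> may be followed by \<open>a x\<close> or by \<open>b x\<close>, and in both
  cases the orbit can go on with \<open>a b x\<close>, \<open>a\<^sup>2 b x\<close>, and so on, until it enters the core again.  The
  two choices lead to the same core point at the same time, and this time is bounded by a constant
  \<open>K\<close>.  So the choice can be repeated freely, and after \<open>k K\<close> steps there are \<open>2\<^sup>k\<close> orbits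
  (lemma \<open>branching_orbits\<close>).  The two choices are told apart by the cover by \<open>[0, 1/a)\<close> and
  \<open>(b/a, 1]\<close>, because \<open>a x \<ge> 1/a\<close> while \<open>b x \<le> b/a\<close>.  Hence the entropy of this cover is at least
  \<open>(ln 2) / (2 K)\<close>, where the factor 2 pays for rounding times to multiples of \<open>K\<close>; that it is
  a genuine limit follows from submultiplicativity of the cover numbers (lemma \<open>cover_number_mahavier_add_le\<close>) and Fekete's lemma.

  The relation is closed, and a closed graph over a compact target gives upper semicontinuity.
\<close>

section \<open>Subadditive sequences\<close>

text \<open>
  Fekete's lemma for nonnegative sequences.  The limit is the infimum \<open>L\<close> of the averages: if the
  average at \<open>n\<close> is close to \<open>L\<close>, division with remainder \<open>m = q n + r\<close> bounds \<open>v m\<close> by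
  \<open>q v n\<close> plus one of the finitely many values \<open>v r\<close> with \<open>r < n\<close>.
\<close>
lemma subadditive_average_convergent:
  fixes v :: "nat \<Rightarrow> real"
  assumes sub: "\<And>m n. v (m + n) \<le> v m + v n" and nonneg: "\<And>n. v n \<ge> 0"
  shows "convergent (\<lambda>m. v m / real m)"
proof -
  define L where "L = (INF n\<in>{1..}. v n / real n)"
  have bdd: "bdd_below ((\<lambda>n. v n / real n) ` {1..})"
    by (rule bdd_belowI[of _ 0]) (auto simp: nonneg)
  have mult: "v (q * n + r) \<le> real q * v n + v r" for q n r
  proof (induction q)
    case (Suc q)
    have "v (Suc q * n + r) = v (n + (q * n + r))" by (simp add: algebra_simps)
    also have "\<dots> \<le> v n + v (q * n + r)" by (rule sub)
    finally show ?case using Suc by (simp add: algebra_simps)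
  qed simp
  have "(\<lambda>m. v m / real m) \<longlonglongrightarrow> L"
  proof (rule LIMSEQ_I)
    fix e :: real assume e: "e > 0"
    have "L < L + e / 2" using e by simp
    then obtain n where n: "n \<ge> 1" "v n / real n < L + e / 2"
      unfolding L_def using bdd by (subst (asm) cINF_less_iff) (auto simp: L_def)
    define C where "C = (\<Sum>r<n. v r)"
    have C: "v r \<le> C" if "r < n" for r
      unfolding C_def using that nonneg by (intro member_le_sum) auto
    obtain M :: nat where M: "2 * C / e < real M" using reals_Archimedean2 by blast
    show "\<exists>no. \<forall>m\<ge>no. norm (v m / real m - L) < e"
    proof (intro exI allI impI)
      fix m assume m: "m \<ge> max 1 M"
      then have m1: "real m \<ge> 1" and mM: "real m \<ge> real M" by simp_all
      have "v m = v (m div n * n + m mod n)" by simp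
      also have "\<dots> \<le> real (m div n) * v n + v (m mod n)" by (rule mult)
      also have "\<dots> \<le> real (m div n) * v n + C" using C n by simp
      finally have vm: "v m \<le> real (m div n) * v n + C" .
      have "real (m div n) * real n \<le> real m"
        by (metis of_nat_le_iff of_nat_mult div_times_less_eq_dividend)
      then have "real (m div n) \<le> real m / real n" using n by (simp add: field_simps)
      then have "real (m div n) * v n \<le> real m / real n * v n"
        by (rule mult_right_mono) (rule nonneg)
      with vm have "v m \<le> real m * (v n / real n) + C" by simp
      then have "v m / real m \<le> v n / real n + C / real m"
        using m1 by (simp add: field_simps)
      moreover have "C / real m < e / 2"
      proof -
        have "2 * C < real M * e" using M e by (simp add: field_simps)
        also have "\<dots> \<le> real m * e" using mM e by (intro mult_right_mono) auto
        finally have "2 * C < real m * e" .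
        then show ?thesis using m1 by (simp add: field_simps)
      qed
      ultimately have "v m / real m < L + e" using n by linarith
      moreover have "L \<le> v m / real m"
        unfolding L_def using m by (intro cINF_lower bdd) auto
      ultimately show "norm (v m / real m - L) < e" by simp
    qed
  qed
  then show ?thesis by (rule convergentI)
qed

section \<open>Cover numbers of Mahavier products\<close>

lemma finite_cover_power:
  assumes "finite \<alpha>"
  shows "finite (cover_power \<alpha> n)"
proof -
  have "cover_power \<alpha> n \<subseteq> Pi\<^sub>E {..<n} ` ({..<n} \<rightarrow>\<^sub>E \<alpha>)"
  proof
    fix P assume "P \<in> cover_power \<alpha> n"
    then obtain A where A: "P = Pi\<^sub>E {..<n} A" "\<forall>j<n. A j \<in> \<alpha>"
      by (auto simp: cover_power_def)
    then have "P = Pi\<^sub>E {..<n} (restrict A {..<n})"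
      by (auto intro!: PiE_cong)
    moreover have "restrict A {..<n} \<in> {..<n} \<rightarrow>\<^sub>E \<alpha>" using A by auto
    ultimately show "P \<in> Pi\<^sub>E {..<n} ` ({..<n} \<rightarrow>\<^sub>E \<alpha>)" by blast
  qed
  moreover have "finite ({..<n} \<rightarrow>\<^sub>E \<alpha>)" using assms by (intro finite_PiE) auto
  ultimately show ?thesis using finite_surj by blast
qed

lemma mahavier_product_subset_cover_power:
  assumes "\<Union>\<alpha> = X"
  shows "mahavier_product X G m \<subseteq> \<Union> (cover_power \<alpha> (m + 1))"
proof
  fix x assume "x \<in> mahavier_product X G m"
  then have x: "x \<in> {..<m + 1} \<rightarrow>\<^sub>E X" by (simp add: mahavier_product_def)
  have "\<forall>i. \<exists>A. i < m + 1 \<longrightarrow> A \<in> \<alpha> \<and> x i \<in> A"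
    using x assms by (blast dest: PiE_mem)
  then obtain A where A: "\<And>i. i < m + 1 \<Longrightarrow> A i \<in> \<alpha> \<and> x i \<in> A i" by metis
  then have "x \<in> Pi\<^sub>E {..<m + 1} A" using x by (auto simp: PiE_iff)
  moreover have "Pi\<^sub>E {..<m + 1} A \<in> cover_power \<alpha> (m + 1)"
    using A unfolding cover_power_def by blast
  ultimately show "x \<in> \<Union> (cover_power \<alpha> (m + 1))" by blast
qed

lemma cover_number_le:
  assumes "\<S> \<subseteq> \<B>" "finite \<S>" "K \<subseteq> \<Union>\<S>"
  shows "cover_number K \<B> \<le> card \<S>"
  unfolding cover_number_def using assms by (intro Least_le) blast

lemma cover_number_attained:
  assumes "finite \<B>" "K \<subseteq> \<Union>\<B>"
  obtains \<S> where "\<S> \<subseteq> \<B>" "finite \<S>" "K \<subseteq> \<Union>\<S>" "card \<S> = cover_number K \<B>"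
proof -
  have "\<exists>\<S>\<subseteq>\<B>. finite \<S> \<and> K \<subseteq> \<Union>\<S> \<and> card \<S> = cover_number K \<B>"
    unfolding cover_number_def by (rule LeastI_ex) (use assms in blast)
  then show ?thesis using that by blast
qed

text \<open>Points no two of which share a member of the family need one member each.\<close>
lemma card_separated_le_cover_number:
  assumes "finite \<B>" "K \<subseteq> \<Union>\<B>"
    and pK: "p ` J \<subseteq> K"
    and sep: "\<And>B i j. B \<in> \<B> \<Longrightarrow> i \<in> J \<Longrightarrow> j \<in> J \<Longrightarrow> p i \<in> B \<Longrightarrow> p j \<in> B \<Longrightarrow> i = j"
  shows "card J \<le> cover_number K \<B>"
proof -
  obtain \<S> where S: "\<S> \<subseteq> \<B>" "finite \<S>" "K \<subseteq> \<Union>\<S>" "card \<S> = cover_number K \<B>"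
    using cover_number_attained[OF assms(1,2)] .
  have "\<forall>j\<in>J. \<exists>B\<in>\<S>. p j \<in> B" using pK S by blast
  then obtain f where f: "\<And>j. j \<in> J \<Longrightarrow> f j \<in> \<S> \<and> p j \<in> f j" by metis
  have "inj_on f J"
  proof (rule inj_onI)
    fix i j assume ij: "i \<in> J" "j \<in> J" "f i = f j"
    then have "p i \<in> f i" "p j \<in> f i" "f i \<in> \<B>" using f S by auto
    then show "i = j" using sep ij by blast
  qed
  then have "card J \<le> card \<S>" using f S by (intro card_inj_on_le) auto
  then show ?thesis using S by simp
qed

text \<open>
  A point of the longer product splits into two shorter ones that share the coordinate with
  number \<open>m\<close>.  A box for the first and a box for the second combine to a box for the whole point;
  for the shared coordinate the side of the first box is used.
\<close>
lemma cover_number_mahavier_add_le: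
  assumes fin: "finite \<alpha>" and un: "\<Union>\<alpha> = X"
  shows "cover_number (mahavier_product X G (m + n)) (cover_power \<alpha> (m + n + 1))
    \<le> cover_number (mahavier_product X G m) (cover_power \<alpha> (m + 1)) *
      cover_number (mahavier_product X G n) (cover_power \<alpha> (n + 1))"
proof -
  note att = cover_number_attained[OF finite_cover_power[OF fin]
      mahavier_product_subset_cover_power[OF un]]
  obtain \<S> where S: "\<S> \<subseteq> cover_power \<alpha> (m + 1)" "finite \<S>" "mahavier_product X G m \<subseteq> \<Union>\<S>"
      "card \<S> = cover_number (mahavier_product X G m) (cover_power \<alpha> (m + 1))"
    using att .
  obtain \<T> where T: "\<T> \<subseteq> cover_power \<alpha> (n + 1)" "finite \<T>" "mahavier_product X G n \<subseteq> \<Union>\<T>"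
      "card \<T> = cover_number (mahavier_product X G n) (cover_power \<alpha> (n + 1))"
    using att .
  have "\<forall>P. \<exists>A. P \<in> \<S> \<longrightarrow> P = Pi\<^sub>E {..<m + 1} A \<and> (\<forall>j<m + 1. A j \<in> \<alpha>)"
    using S(1) unfolding cover_power_def by blast
  then obtain A where A: "\<And>P. P \<in> \<S> \<Longrightarrow> P = Pi\<^sub>E {..<m + 1} (A P) \<and> (\<forall>j<m + 1. A P j \<in> \<alpha>)"
    by metis
  have "\<forall>Q. \<exists>B. Q \<in> \<T> \<longrightarrow> Q = Pi\<^sub>E {..<n + 1} B \<and> (\<forall>j<n + 1. B j \<in> \<alpha>)"
    using T(1) unfolding cover_power_def by blast
  then obtain B where B: "\<And>Q. Q \<in> \<T> \<Longrightarrow> Q = Pi\<^sub>E {..<n + 1} (B Q) \<and> (\<forall>j<n + 1. B Q j \<in> \<alpha>)"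
    by metis
  define side where "side P Q = (\<lambda>i. if i \<le> m then A P i else B Q (i - m))" for P Q
  define \<U> where "\<U> = (\<lambda>(P, Q). Pi\<^sub>E {..<m + n + 1} (side P Q)) ` (\<S> \<times> \<T>)"
  have side: "side P Q j \<in> \<alpha>" if "P \<in> \<S>" "Q \<in> \<T>" "j < m + n + 1" for P Q j
    using A[OF that(1)] B[OF that(2)] that(3) by (auto simp: side_def)
  have "\<U> \<subseteq> cover_power \<alpha> (m + n + 1)"
  proof
    fix R assume "R \<in> \<U>"
    then obtain P Q where "P \<in> \<S>" "Q \<in> \<T>" "R = Pi\<^sub>E {..<m + n + 1} (side P Q)"
      unfolding \<U>_def by blast
    then show "R \<in> cover_power \<alpha> (m + n + 1)"
      using side unfolding cover_power_def by blast
  qed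
  moreover have "finite \<U>" unfolding \<U>_def using S T by simp
  moreover have "mahavier_product X G (m + n) \<subseteq> \<Union>\<U>"
  proof
    fix x assume "x \<in> mahavier_product X G (m + n)"
    then have x: "x \<in> {..<m + n + 1} \<rightarrow>\<^sub>E X" "\<And>i. i < m + n \<Longrightarrow> (x (i + 1), x i) \<in> G"
      by (auto simp: mahavier_product_def)
    define y where "y = restrict x {..<m + 1}"
    define z where "z = restrict (\<lambda>i. x (m + i)) {..<n + 1}"
    have "y \<in> mahavier_product X G m"
      using x by (auto simp: mahavier_product_def y_def PiE_iff)
    then obtain P where P: "P \<in> \<S>" "y \<in> P" using S by blast
    have "z \<in> mahavier_product X G n"
      using x by (auto simp: mahavier_product_def z_def PiE_iff)
    then obtain Q where Q: "Q \<in> \<T>" "z \<in> Q" using T by blast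
    have "x i \<in> A P i" if "i \<le> m" for i
    proof -
      have "y i \<in> A P i" using A[OF P(1)] P(2) that by (metis PiE_mem lessThan_iff less_Suc_eq_le Suc_eq_plus1)
      then show ?thesis using that by (simp add: y_def)
    qed
    moreover have "x i \<in> B Q (i - m)" if "m < i" "i < m + n + 1" for i
    proof -
      have "i - m < n + 1" using that by simp
      then have "z (i - m) \<in> B Q (i - m)" using B[OF Q(1)] Q(2) by (metis PiE_mem lessThan_iff)
      moreover have "m + (i - m) = i" using that by simp
      ultimately show ?thesis using \<open>i - m < n + 1\<close> by (simp add: z_def)
    qed
    ultimately have "x \<in> Pi\<^sub>E {..<m + n + 1} (side P Q)"
      using x(1) by (auto simp: PiE_iff side_def)
    then show "x \<in> \<Union>\<U>" unfolding \<U>_def using P Q by blast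
  qed
  ultimately have "cover_number (mahavier_product X G (m + n)) (cover_power \<alpha> (m + n + 1)) \<le> card \<U>"
    by (rule cover_number_le)
  also have "\<dots> \<le> card (\<S> \<times> \<T>)" unfolding \<U>_def using S T by (intro card_image_le) simp
  finally show ?thesis using S T by (simp add: card_cartesian_product)
qed

text \<open>
  Subadditivity of the logarithms makes the limit in the definition exist, so that a lower bound
  along the sequence passes to it.  Rounding \<open>m\<close> down to a multiple of \<open>K\<close> loses at most a
  factor 2 once \<open>m \<ge> K\<close>.
\<close>
lemma cover_entropy_pos:
  assumes fin: "finite \<alpha>" and un: "\<Union>\<alpha> = X" and K: "K \<ge> 1"
    and growth: "\<And>k m. k * K \<le> m \<Longrightarrow>
      2 ^ k \<le> cover_number (mahavier_product X G m) (cover_power \<alpha> (m + 1))"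
  shows "cover_entropy X G \<alpha> > 0"
proof -
  define N where "N m = cover_number (mahavier_product X G m) (cover_power \<alpha> (m + 1))" for m
  define v where "v m = ln (real (N m))" for m
  have growth': "2 ^ k \<le> N m" if "k * K \<le> m" for k m
    using growth[OF that] by (simp add: N_def)
  have N1: "N m \<ge> 1" for m using growth'[of 0 m] by simp
  have "v (m + n) \<le> v m + v n" for m n
  proof -
    have "N (m + n) \<le> N m * N n"
      unfolding N_def using cover_number_mahavier_add_le[OF fin un] .
    then have "real (N (m + n)) \<le> real (N m) * real (N n)"
      by (metis of_nat_le_iff of_nat_mult)
    moreover have "real (N (m + n)) > 0" using N1[of "m + n"] by simp
    ultimately have "ln (real (N (m + n))) \<le> ln (real (N m) * real (N n))"
      by simp
    also have "\<dots> = ln (real (N m)) + ln (real (N n))"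
      using N1[of m] N1[of n] by (simp add: ln_mult)
    finally show ?thesis by (simp add: v_def)
  qed
  moreover have "v n \<ge> 0" for n using N1[of n] by (simp add: v_def)
  ultimately have "convergent (\<lambda>m. v m / real m)" by (rule subadditive_average_convergent)
  then obtain L where L: "(\<lambda>m. v m / real m) \<longlonglongrightarrow> L" by (auto simp: convergent_def)
  have "ln 2 / (2 * real K) \<le> v m / real m" if m: "m \<ge> K" for m
  proof -
    define k where "k = m div K"
    have "m < (k + 1) * K" unfolding k_def using K
      by (metis Suc_eq_plus1 dividend_less_times_div mult.commute mult_Suc_right add.commute less_le_trans zero_less_one)
    moreover have "k \<ge> 1" unfolding k_def using m K by (simp add: Suc_leI div_greater_zero_iff)
    ultimately have "m \<le> 2 * (k * K)" by (cases k) (auto simp: algebra_simps)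
    then have mk: "real m \<le> 2 * real k * real K"
      by (metis of_nat_le_iff of_nat_mult of_nat_numeral mult.assoc)
    have "k * K \<le> m" by (simp add: k_def)
    then have "(2::real) ^ k \<le> real (N m)"
      using growth'[of k m] by (metis of_nat_le_iff of_nat_numeral of_nat_power)
    then have "ln ((2::real) ^ k) \<le> v m"
      unfolding v_def by (intro ln_mono) auto
    then have vk: "real k * ln 2 \<le> v m" by (simp add: ln_realpow)
    have "ln 2 * real m \<le> ln 2 * (2 * real k * real K)" using mk by (intro mult_left_mono) auto
    also have "\<dots> = (real k * ln 2) * (2 * real K)" by simp
    also have "\<dots> \<le> v m * (2 * real K)" using vk by (intro mult_right_mono) auto
    finally show ?thesis using m K by (simp add: field_simps)
  qed
  then have "ln 2 / (2 * real K) \<le> L"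
    using L by (intro LIMSEQ_le_const) blast+
  moreover have "ln 2 / (2 * real K) > 0" using K by simp
  moreover have "cover_entropy X G \<alpha> = L"
    unfolding cover_entropy_def using L by (intro limI) (simp add: v_def N_def)
  ultimately show ?thesis by linarith
qed

section \<open>Closed graphs and upper semicontinuity\<close>

text \<open>
  The points whose value meets the closed set \<open>Y - U\<close> form the projection of a closed set along
  the compact factor \<open>Y\<close>, hence a closed set; its complement is the required neighbourhood.
\<close>
lemma closed_graph_upper_semicontinuous:
  assumes Y: "compact Y" and G: "closedin (top_of_set (X \<times> Y)) G"
  shows "upper_semicontinuous X Y (\<lambda>x. {y. (x, y) \<in> G})"
  unfolding upper_semicontinuous_def
proof (intro ballI allI impI)
  fix x0 U assume x0: "x0 \<in> X" and "openin (top_of_set Y) U \<and> {y. (x0, y) \<in> G} \<subseteq> U"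
  then have U: "openin (top_of_set Y) U" and sub: "{y. (x0, y) \<in> G} \<subseteq> U" by auto
  define C where "C = G \<inter> X \<times> (Y - U)"
  have top: "top_of_set (X \<times> Y) = prod_topology (top_of_set X) (top_of_set Y)"
    by (simp add: subtopology_Times)
  have "closedin (top_of_set Y) (Y - U)" using U by (simp add: closedin_diff)
  then have "closedin (prod_topology (top_of_set X) (top_of_set Y)) (X \<times> (Y - U))"
    by (simp add: closedin_prod_Times_iff del: prod_topology_subtopology_eu)
  then have "closedin (prod_topology (top_of_set X) (top_of_set Y)) C"
    unfolding C_def using G by (intro closedin_Int) (simp_all only: top)
  moreover have "closed_map (prod_topology (top_of_set X) (top_of_set Y)) (top_of_set X) fst"
    using Y by (intro Abstract_Topological_Spaces.closed_map_fst) (simp add: compact_space_subtopology)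
  ultimately have cl: "closedin (top_of_set X) (fst ` C)" by (auto simp: closed_map_def)
  have "openin (top_of_set X) (X - fst ` C)"
    using cl by (simp add: openin_diff)
  moreover have "x0 \<notin> fst ` C" using sub by (auto simp: C_def)
  moreover have "{y. (x, y) \<in> G} \<subseteq> U" if "x \<in> X - fst ` C" for x
  proof
    fix y assume y: "y \<in> {y. (x, y) \<in> G}"
    then have "y \<in> Y" using closedin_subset[OF G] by auto
    show "y \<in> U"
    proof (rule ccontr)
      assume "y \<notin> U"
      then have "(x, y) \<in> C" using y that \<open>y \<in> Y\<close> by (auto simp: C_def)
      then show False using that by force
    qed
  qed
  ultimately show "\<exists>V. openin (top_of_set X) V \<and> x0 \<in> V \<and> (\<forall>x\<in>V. {y. (x, y) \<in> G} \<subseteq> U)"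
    using x0 by (intro exI[of _ "X - fst ` C"]) auto
qed

section \<open>The relation \<open>H\<close>\<close>

locale scaling_pair =
  fixes a b :: real
  assumes a_gt_1: "a > 1" and b_pos: "b > 0" and b_less: "b < 1 / a"
begin

lemma ab_less_1: "a * b < 1"
  using a_gt_1 b_less by (simp add: field_simps)

lemma b_less_1: "b < 1"
  using a_gt_1 b_less by (smt (verit) divide_le_eq_1)

lemma critical_order:
  "0 < b / a\<^sup>2" "b / a\<^sup>2 < b / a" "b / a < 1 / a\<^sup>2" "1 / a\<^sup>2 < 1 / a" "1 / a < 1"
proof -
  show "0 < b / a\<^sup>2" using a_gt_1 b_pos by simp
  show "b / a\<^sup>2 < b / a" using a_gt_1 b_pos by (simp add: field_simps power2_eq_square)
  show "b / a < 1 / a\<^sup>2" using a_gt_1 ab_less_1 by (simp add: field_simps power2_eq_square)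
  show "1 / a\<^sup>2 < 1 / a" using a_gt_1 by (simp add: field_simps power2_eq_square)
  show "1 / a < 1" using a_gt_1 by simp
qed

lemma H_rel_mult_a:
  assumes "b / a\<^sup>2 \<le> x" "x \<le> 1 / a"
  shows "(x, a * x) \<in> H_rel a b"
proof -
  have "0 \<le> x" "x \<le> 1" using assms critical_order by linarith+
  moreover have "a * x \<le> 1" using assms a_gt_1 by (simp add: field_simps)
  ultimately show ?thesis using assms a_gt_1 by (auto simp: H_rel_def H_ab_def)
qed

lemma H_rel_mult_b:
  assumes "1 / a\<^sup>2 \<le> x" "x \<le> 1"
  shows "(x, b * x) \<in> H_rel a b"
proof -
  have "0 \<le> x" using assms critical_order by linarith
  moreover have "b * x \<le> 1" using assms b_less_1 \<open>0 \<le> x\<close> mult_le_one[of b x] by simp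
  ultimately show ?thesis using assms b_pos by (auto simp: H_rel_def H_ab_def)
qed

lemma H_rel_eq:
  "H_rel a b =
     {p. b / a\<^sup>2 \<le> fst p \<and> fst p \<le> 1 / a \<and> snd p = a * fst p} \<union>
     {p. 1 / a\<^sup>2 \<le> fst p \<and> fst p \<le> 1 \<and> snd p = b * fst p} \<union> {0..b / a\<^sup>2} \<times> {b / a}"
  (is "_ = ?A \<union> ?B \<union> ?C")
proof
  show "H_rel a b \<subseteq> ?A \<union> ?B \<union> ?C" by (auto simp: H_rel_def H_ab_def)
  show "?A \<union> ?B \<union> ?C \<subseteq> H_rel a b"
  proof (intro Un_least)
    show "?A \<subseteq> H_rel a b" using H_rel_mult_a by auto
    show "?B \<subseteq> H_rel a b" using H_rel_mult_b by auto
    show "?C \<subseteq> H_rel a b" by (auto simp: H_rel_def)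
  qed
qed

lemma H_rel_subset: "H_rel a b \<subseteq> {0..1} \<times> {0..1}"
  using critical_order by (auto simp: H_rel_def H_ab_def)

lemma closed_H_rel: "closed (H_rel a b)"
proof -
  have "closed {p::real \<times> real. b / a\<^sup>2 \<le> fst p \<and> fst p \<le> 1 / a \<and> snd p = a * fst p}"
    by (intro closed_Collect_conj closed_Collect_le closed_Collect_eq continuous_intros)
  moreover have "closed {p::real \<times> real. 1 / a\<^sup>2 \<le> fst p \<and> fst p \<le> 1 \<and> snd p = b * fst p}"
    by (intro closed_Collect_conj closed_Collect_le closed_Collect_eq continuous_intros)
  moreover have "closed ({0..b / a\<^sup>2} \<times> {b / a})" by (intro closed_Times) auto
  ultimately show ?thesis unfolding H_rel_eq by (intro closed_Un)
qed

lemma closed_relation_H_rel: "closed_relation {0..1} (H_rel a b)"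
  unfolding closed_relation_def using closed_H_rel H_rel_subset by (rule closed_subset[rotated])

lemma H_rel_total:
  assumes "x \<in> {0..1}"
  shows "\<exists>y. (x, y) \<in> H_rel a b"
proof (cases "x \<le> b / a\<^sup>2")
  case True
  then show ?thesis using assms by (auto simp: H_rel_def)
next
  case False
  show ?thesis
  proof (cases "x \<le> 1 / a")
    case True
    then show ?thesis using False H_rel_mult_a[of x] by auto
  next
    case f: False
    then show ?thesis using assms critical_order H_rel_mult_b[of x] by fastforce
  qed
qed

lemma H_rel_graph_usc:
  "\<exists>F. F \<in> {0..1} \<rightarrow> hyperspace {0..1} \<and> upper_semicontinuous {0..1} {0..1} F \<and>
     H_rel a b = set_valued_graph {0..1} {0..1} F"
proof (intro exI conjI)
  let ?F = "\<lambda>x. {y. (x, y) \<in> H_rel a b}"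
  show "upper_semicontinuous {0..1} {0..1} ?F"
    using closed_relation_H_rel
    by (intro closed_graph_upper_semicontinuous) (auto simp: closed_relation_def)
  show "H_rel a b = set_valued_graph {0..1} {0..1} ?F"
    using H_rel_subset by (auto simp: set_valued_graph_def)
  show "?F \<in> {0..1} \<rightarrow> hyperspace {0..1}"
  proof
    fix x :: real assume x: "x \<in> {0..1}"
    have "closed (Pair x -` H_rel a b)"
      by (intro continuous_closed_vimage closed_H_rel) (auto intro!: continuous_intros)
    then have "closed (?F x)" by (simp add: vimage_def)
    moreover have "?F x \<subseteq> {0..1}" using H_rel_subset by auto
    ultimately have "closedin (top_of_set {0..1}) (?F x)" by (metis closed_subset)
    then show "?F x \<in> hyperspace {0..1}"
      using H_rel_total[OF x] by (auto simp: hyperspace_def)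
  qed
qed

section \<open>Absence of periodic points\<close>

lemma H_rel_range_ge:
  assumes "(x, y) \<in> H_rel a b"
  shows "b / a\<^sup>2 \<le> y"
proof -
  consider "b / a\<^sup>2 \<le> x" "y = a * x" | "1 / a\<^sup>2 \<le> x" "y = b * x" | "y = b / a"
    using assms unfolding H_rel_eq by auto
  then show ?thesis
  proof cases
    case 1
    have "b / a\<^sup>2 \<le> x" by (rule 1)
    also have "x \<le> a * x" using 1 critical_order a_gt_1 by simp
    finally show ?thesis using 1 by simp
  next
    case 2
    then have "b * (1 / a\<^sup>2) \<le> b * x" using b_pos by (intro mult_left_mono) auto
    then show ?thesis using 2 by simp
  next
    case 3
    then show ?thesis using critical_order by simp
  qed
qed

lemma H_rel_step:
  assumes "(x, y) \<in> H_rel a b" "b / a\<^sup>2 \<le> x"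
  shows "y = a * x \<or> y = b * x"
proof -
  have "a * (b / a\<^sup>2) = b / a" using a_gt_1 by (simp add: power2_eq_square)
  then show ?thesis using assms unfolding H_rel_eq by auto
qed

lemma H_rel_no_periodic_point:
  assumes irr: "\<And>k::nat. k \<ge> 1 \<Longrightarrow> a ^ k \<notin> \<rat>" and rat: "b \<in> \<rat>"
  shows "\<not> periodic_point {0..1} (H_rel a b) x"
proof
  assume "periodic_point {0..1} (H_rel a b) x"
  then obtain n where x: "\<And>i. (x (i + 1), x i) \<in> H_rel a b" and n: "n \<ge> 1"
      "(shift_map ^^ n) x = x"
    by (auto simp: periodic_point_def inf_mahavier_product_def)
  have "(shift_map ^^ n) x i = x (i + n)" for i
    by (induction n arbitrary: i) (simp_all add: shift_map_def)
  then have xn: "x n = x 0" using n(2) by (metis add_0)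
  have pos: "b / a\<^sup>2 \<le> x i" for i using H_rel_range_ge x by blast
  have "\<exists>k l. k + l = m \<and> x 0 = a ^ k * b ^ l * x m" for m
  proof (induction m)
    case (Suc m)
    then obtain k l where kl: "k + l = m" "x 0 = a ^ k * b ^ l * x m" by blast
    have "x m = a * x (Suc m) \<or> x m = b * x (Suc m)"
      using H_rel_step[OF x pos, of m] by simp
    then show ?case
    proof
      assume "x m = a * x (Suc m)"
      then show ?thesis using kl by (intro exI[of _ "Suc k"] exI[of _ l]) simp
    next
      assume "x m = b * x (Suc m)"
      then show ?thesis using kl by (intro exI[of _ k] exI[of _ "Suc l"]) simp
    qed
  qed simp
  then obtain k l where kl: "k + l = n" "x 0 = a ^ k * b ^ l * x n" by blast
  have "x 0 > 0" using pos[of 0] critical_order by linarith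
  moreover have "1 * x 0 = a ^ k * b ^ l * x 0" using kl(2) unfolding xn by simp
  ultimately have eq: "a ^ k * b ^ l = 1" by (metis less_irrefl mult_cancel_right)
  show False
  proof (cases "k = 0")
    case True
    then have "b ^ n = 1" using eq kl by simp
    moreover have "b ^ n < 1"
      using b_pos b_less_1 n by (simp add: power_less_one_iff)
    ultimately show False by simp
  next
    case False
    have "a ^ k = inverse (b ^ l)" using eq by (simp add: inverse_unique mult.commute)
    moreover have "inverse (b ^ l) \<in> \<rat>" using rat by simp
    ultimately show False using irr[of k] False by simp
  qed
qed

section \<open>Positive entropy\<close>

definition orbit :: "(nat \<Rightarrow> real) \<Rightarrow> bool" where
  "orbit y \<longleftrightarrow> (\<forall>i. (y i, y (Suc i)) \<in> H_rel a b)"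

definition across_gap :: "real \<Rightarrow> real \<Rightarrow> bool" where
  "across_gap s t \<longleftrightarrow> 1 / a \<le> s \<and> t \<le> b / a \<or> 1 / a \<le> t \<and> s \<le> b / a"

lemma orbit_exists:
  assumes "x \<in> {0..1}"
  obtains y where "orbit y" "y 0 = x"
proof -
  have "\<exists>y. \<forall>n. (y n \<in> {0..1} \<and> (n = 0 \<longrightarrow> y n = x)) \<and> (y n, y (Suc n)) \<in> H_rel a b"
  proof (rule dependent_nat_choice)
    show "\<exists>z. z \<in> {0..1} \<and> ((0::nat) = 0 \<longrightarrow> z = x)" using assms by blast
  next
    fix z :: real and n :: nat assume "z \<in> {0..1} \<and> (n = 0 \<longrightarrow> z = x)"
    then obtain z' where "(z, z') \<in> H_rel a b" using H_rel_total by blast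
    moreover from this have "z' \<in> {0..1}" using H_rel_subset by blast
    ultimately show "\<exists>z'. (z' \<in> {0..1} \<and> (Suc n = 0 \<longrightarrow> z' = x)) \<and> (z, z') \<in> H_rel a b"
      by blast
  qed
  then obtain y where "\<And>n. (y n \<in> {0..1} \<and> (n = 0 \<longrightarrow> y n = x)) \<and> (y n, y (Suc n)) \<in> H_rel a b"
    by blast
  then show ?thesis using that[of y] by (simp add: orbit_def)
qed

text \<open>
  The first exponent that lifts \<open>b x\<close> to \<open>1/a\<^sup>2\<close> does not overshoot the core, since the core spans
  exactly one factor \<open>a\<close>.
\<close>
lemma core_return:
  assumes x: "1 / a\<^sup>2 \<le> x" "x \<le> 1 / a" and M: "1 \<le> b * a ^ M"
  obtains k where "1 \<le> k" "k \<le> M" "1 / a\<^sup>2 \<le> b * a ^ k * x" "b * a ^ k * x \<le> 1 / a"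
    "\<And>i. i < k \<Longrightarrow> b * a ^ i * x < 1 / a\<^sup>2"
proof -
  define P where "P k \<longleftrightarrow> 1 / a\<^sup>2 \<le> b * a ^ k * x" for k
  define k where "k = (LEAST k. P k)"
  have x0: "x > 0" using x critical_order by linarith
  have "x \<le> b * a ^ M * x" using M x0 by simp
  then have PM: "P M" unfolding P_def using x by linarith
  then have Pk: "P k" and kM: "k \<le> M" unfolding k_def by (auto intro: LeastI Least_le)
  have less: "b * a ^ i * x < 1 / a\<^sup>2" if "i < k" for i
    using not_less_Least[of i P] that by (auto simp: k_def P_def)
  have "b * x \<le> b / a" using x b_pos mult_left_mono[of x "1 / a" b] by simp
  then have "\<not> P 0" unfolding P_def using critical_order by simp
  then have "k \<noteq> 0" using Pk by metis
  then obtain j where j: "k = Suc j" using not0_implies_Suc by blast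
  have "b * a ^ k * x = a * (b * a ^ j * x)" using j by simp
  also have "\<dots> \<le> a * (1 / a\<^sup>2)" using less[of j] j a_gt_1 by (intro mult_left_mono) auto
  also have "\<dots> = 1 / a" using a_gt_1 by (simp add: power2_eq_square)
  finally show ?thesis using that[of k] j kM Pk less by (simp add: P_def)
qed

text \<open>
  Words of length \<open>k\<close> record the choices between \<open>a x\<close> and \<open>b x\<close> at the start and at the
  following \<open>k - 1\<close> returns.  Since \<open>a b = b a\<close>, neither the point nor the time of a return depends on the choice,
  so one family of continuations serves both; and the orbits of two words that first differ at
  some letter make the corresponding choice at the same time, which separates them.
\<close>
lemma branching_orbits:
  assumes M: "1 \<le> b * a ^ M" and x: "1 / a\<^sup>2 \<le> x" "x \<le> 1 / a"
  shows "\<exists>Y :: bool list \<Rightarrow> nat \<Rightarrow> real.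
    (\<forall>w. length w = k \<longrightarrow> orbit (Y w) \<and> Y w 0 = x) \<and>
    (\<forall>w w'. length w = k \<longrightarrow> length w' = k \<longrightarrow> w \<noteq> w' \<longrightarrow>
       (\<exists>i \<le> k * (M + 1). across_gap (Y w i) (Y w' i)))"
  using x
proof (induction k arbitrary: x)
  case 0
  then have "x \<in> {0..1}" using critical_order by simp
  then obtain y where "orbit y" "y 0 = x" by (rule orbit_exists)
  then show ?case by (intro exI[of _ "\<lambda>w. y"]) auto
next
  case (Suc k)
  have x0: "x > 0" using Suc.prems critical_order by linarith
  obtain r where r: "1 \<le> r" "r \<le> M" "1 / a\<^sup>2 \<le> b * a ^ r * x" "b * a ^ r * x \<le> 1 / a"
    and low: "\<And>i. i < r \<Longrightarrow> b * a ^ i * x < 1 / a\<^sup>2"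
    using core_return[OF Suc.prems M] by metis
  obtain Y :: "bool list \<Rightarrow> nat \<Rightarrow> real"
    where Y': "\<forall>w. length w = k \<longrightarrow> orbit (Y w) \<and> Y w 0 = b * a ^ r * x"
      and sep': "\<forall>w w'. length w = k \<longrightarrow> length w' = k \<longrightarrow> w \<noteq> w' \<longrightarrow>
        (\<exists>i \<le> k * (M + 1). across_gap (Y w i) (Y w' i))"
    using Suc.IH[OF r(3,4)] by (elim exE conjE) (rule that)
  note Y = Y'[rule_format] and sep = sep'[rule_format]
  \<comment> \<open>Up to the return at time \<open>r + 1\<close>, the choice is visible at time 1 only.\<close>
  define blk where "blk c i = (if i = 0 then x else if i = 1 \<and> c then a * x else b * a ^ (i - 1) * x)"
    for c and i :: nat
  define Z where "Z w i = (if i \<le> r then blk (hd w) i else Y (tl w) (i - (r + 1)))" for w and i :: nat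
  have blk_step: "(blk c i, b * a ^ i * x) \<in> H_rel a b" if "1 \<le> i" "i \<le> r" for c i
  proof (cases "i = 1 \<and> c")
    case True
    have "1 / a\<^sup>2 * a \<le> x * a" using Suc.prems a_gt_1 by (intro mult_right_mono) auto
    then have "1 / a \<le> a * x" using a_gt_1 by (simp add: power2_eq_square mult.commute)
    moreover have "a * x \<le> 1" using Suc.prems a_gt_1 by (simp add: field_simps)
    ultimately have "(a * x, b * (a * x)) \<in> H_rel a b"
      using critical_order by (intro H_rel_mult_b) linarith+
    then show ?thesis using True by (simp add: blk_def mult_ac)
  next
    case False
    define u where "u = b * a ^ (i - 1) * x"
    have "1 * (1 / a\<^sup>2) \<le> a ^ (i - 1) * x"
      using Suc.prems a_gt_1 x0 by (intro mult_mono) auto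
    then have "b * (1 / a\<^sup>2) \<le> b * (a ^ (i - 1) * x)" using b_pos by (intro mult_left_mono) auto
    then have "b / a\<^sup>2 \<le> u" by (simp add: u_def mult.assoc)
    moreover have "u < 1 / a\<^sup>2" unfolding u_def using that by (intro low) simp
    then have "u \<le> 1 / a" using critical_order by linarith
    ultimately have "(u, a * u) \<in> H_rel a b" by (rule H_rel_mult_a)
    moreover have "a * u = b * a ^ i * x" using that by (cases i) (auto simp: u_def)
    moreover have "blk c i = u" using False that by (auto simp: blk_def u_def)
    ultimately show ?thesis by simp
  qed
  have first: "(x, blk c 1) \<in> H_rel a b" for c
    using H_rel_mult_a[of x] H_rel_mult_b[of x] Suc.prems critical_order by (auto simp: blk_def)
  have Z: "orbit (Z w) \<and> Z w 0 = x" if "length w = Suc k" for w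
  proof
    have tw: "orbit (Y (tl w))" "Y (tl w) 0 = b * a ^ r * x" using Y[of "tl w"] that by auto
    show "Z w 0 = x" by (simp add: Z_def blk_def)
    show "orbit (Z w)" unfolding orbit_def
    proof
      fix i
      consider "i = 0" | "1 \<le> i" "i < r" | "i = r" "1 \<le> i" | "r < i" using r by linarith
      then show "(Z w i, Z w (Suc i)) \<in> H_rel a b"
      proof cases
        case 1
        then show ?thesis using first r by (simp add: Z_def) (simp add: blk_def)
      next
        case 2
        then have "blk (hd w) (Suc i) = b * a ^ i * x" by (simp add: blk_def)
        then show ?thesis using 2 blk_step[of i "hd w"] by (simp add: Z_def)
      next
        case 3
        then show ?thesis using tw blk_step[of i "hd w"] by (simp add: Z_def)
      next
        case 4
        then have "Suc i - (r + 1) = Suc (i - (r + 1))" by simp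
        then show ?thesis using 4 tw(1) by (simp add: Z_def orbit_def)
      qed
    qed
  qed
  have Zsep: "\<exists>i \<le> Suc k * (M + 1). across_gap (Z w i) (Z w' i)"
    if w: "length w = Suc k" "length w' = Suc k" "w \<noteq> w'" for w w'
  proof (cases "hd w = hd w'")
    case False
    have "1 / a\<^sup>2 * a \<le> x * a" using Suc.prems a_gt_1 by (intro mult_right_mono) auto
    then have "1 / a \<le> a * x" using a_gt_1 by (simp add: power2_eq_square mult.commute)
    moreover have "b * x \<le> b / a" using Suc.prems b_pos mult_left_mono[of x "1 / a" b] by simp
    ultimately show ?thesis using False r(1)
      by (intro exI[of _ 1]) (auto simp: Z_def blk_def across_gap_def)
  next
    case True
    then have "tl w \<noteq> tl w'" using w by (cases w; cases w') auto
    then obtain i where i: "i \<le> k * (M + 1)"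
      "across_gap (Y (tl w) i) (Y (tl w') i)"
      using sep[of "tl w" "tl w'"] w by auto
    have "i + (r + 1) \<le> Suc k * (M + 1)" using i(1) r(2) by simp
    moreover have "Z v (i + (r + 1)) = Y (tl v) i" for v by (simp add: Z_def)
    ultimately show ?thesis using i(2) by metis
  qed
  show ?case using Z Zsep by blast
qed

lemma orbit_mahavier_product:
  assumes "orbit y"
  shows "restrict (\<lambda>i. y (m - i)) {..<m + 1} \<in> mahavier_product {0..1} (H_rel a b) m"
proof -
  have "y i \<in> {0..1}" for i using assms H_rel_subset by (auto simp: orbit_def)
  moreover have "(y (m - Suc i), y (m - i)) \<in> H_rel a b" if "i < m" for i
    using assms that by (metis orbit_def Suc_diff_Suc)
  ultimately show ?thesis by (auto simp: mahavier_product_def)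
qed

lemma entropy_H_rel_pos: "entropy {0..1} (H_rel a b) > 0"
proof -
  obtain M where "1 / b < a ^ M" using a_gt_1 real_arch_pow by blast
  then have M: "1 \<le> b * a ^ M" using b_pos by (simp add: field_simps)
  define \<alpha> where "\<alpha> = {{0..<1 / a}, {b / a<..1}}"
  have un: "\<Union>\<alpha> = {0..1}" using critical_order by (auto simp: \<alpha>_def)
  have fin: "finite \<alpha>" by (simp add: \<alpha>_def)
  have gap: "\<not> across_gap s t" if "A \<in> \<alpha>" "s \<in> A" "t \<in> A" for A s t
    using that by (auto simp: \<alpha>_def across_gap_def)
  have growth: "2 ^ k \<le> cover_number (mahavier_product {0..1} (H_rel a b) m) (cover_power \<alpha> (m + 1))"
    if m: "k * (M + 1) \<le> m" for k m
  proof -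
    let ?J = "{w :: bool list. length w = k}"
    obtain Y :: "bool list \<Rightarrow> nat \<Rightarrow> real"
      where Y': "\<forall>w. length w = k \<longrightarrow> orbit (Y w) \<and> Y w 0 = 1 / a"
        and sep': "\<forall>w w'. length w = k \<longrightarrow> length w' = k \<longrightarrow> w \<noteq> w' \<longrightarrow>
          (\<exists>i \<le> k * (M + 1). across_gap (Y w i) (Y w' i))"
      using branching_orbits[OF M less_imp_le[OF critical_order(4)] order_refl, of k]
      by (elim exE conjE) (rule that)
    note Y = Y'[rule_format] and sep = sep'[rule_format]
    \<comment> \<open>Mahavier products list the points of an orbit backwards in time.\<close>
    define p where "p w = restrict (\<lambda>i. Y w (m - i)) {..<m + 1}" for w
    have "card ?J \<le> cover_number (mahavier_product {0..1} (H_rel a b) m) (cover_power \<alpha> (m + 1))"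
    proof (rule card_separated_le_cover_number)
      show "finite (cover_power \<alpha> (m + 1))" using fin by (rule finite_cover_power)
      show "mahavier_product {0..1} (H_rel a b) m \<subseteq> \<Union> (cover_power \<alpha> (m + 1))"
        using un by (rule mahavier_product_subset_cover_power)
      show "p ` ?J \<subseteq> mahavier_product {0..1} (H_rel a b) m"
        unfolding p_def using Y orbit_mahavier_product by auto
    next
      fix B w w' assume B: "B \<in> cover_power \<alpha> (m + 1)" and w: "w \<in> ?J" "w' \<in> ?J"
        and p: "p w \<in> B" "p w' \<in> B"
      obtain A where A: "B = Pi\<^sub>E {..<m + 1} A" "\<And>j. j < m + 1 \<Longrightarrow> A j \<in> \<alpha>"
        using B by (auto simp: cover_power_def)
      show "w = w'"
      proof (rule ccontr)
        assume "w \<noteq> w'"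
        then obtain i where i: "i \<le> k * (M + 1)"
          "across_gap (Y w i) (Y w' i)"
          using sep[of w w'] w by auto
        have mi: "m - i < m + 1" "m - (m - i) = i" using i(1) m by auto
        have "p w (m - i) \<in> A (m - i)" "p w' (m - i) \<in> A (m - i)"
          using p A(1) mi(1) by (auto dest: PiE_mem)
        then have "Y w i \<in> A (m - i)" "Y w' i \<in> A (m - i)" using mi by (auto simp: p_def)
        then show False using gap[OF A(2)[OF mi(1)]] i(2) by blast
      qed
    qed
    moreover have "card ?J = 2 ^ k"
      using card_lists_length_eq[of "UNIV :: bool set" k] by simp
    ultimately show ?thesis by simp
  qed
  have pos: "cover_entropy {0..1} (H_rel a b) \<alpha> > 0"
    using cover_entropy_pos[OF fin un le_add2 growth] .
  have "openin (top_of_set {0..1}) {0..<1 / a}"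
    unfolding openin_open using critical_order by (intro exI[of _ "{..<1 / a}"]) auto
  moreover have "openin (top_of_set {0..1}) {b / a<..1}"
    unfolding openin_open using critical_order by (intro exI[of _ "{b / a<..}"]) auto
  ultimately have "open_cover {0..1} \<alpha>" using un by (auto simp: open_cover_def \<alpha>_def)
  then have "ereal (cover_entropy {0..1} (H_rel a b) \<alpha>)
      \<le> (SUP \<alpha> \<in> {\<alpha>. open_cover {0..1} \<alpha>}. ereal (cover_entropy {0..1} (H_rel a b) \<alpha>))"
    by (intro SUP_upper) simp
  moreover have "H_rel a b \<noteq> {}" using H_rel_total[of 0] by auto
  ultimately show ?thesis unfolding entropy_def using pos
    by simp (metis ereal_less(2) less_le_trans)
qed

end

section \<open>Irrational embedding\<close>

theorem theorem7p2:
  fixes a b :: real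
  assumes "a > 1" and "a \<notin> \<rat>" and "\<And>k::nat. k \<ge> 1 \<Longrightarrow> a ^ k \<notin> \<rat>"
    and "b \<in> {0<..<1}" and "b \<in> \<rat>" and "1 / a > b"
  shows "(\<exists>F. F \<in> {0..1} \<rightarrow> hyperspace {0..1} \<and> upper_semicontinuous {0..1} {0..1} F \<and>
            H_rel a b = set_valued_graph {0..1} {0..1} F)
       \<and> i_embedded {0..1} (H_rel a b)"
proof -
  interpret scaling_pair a b using assms by unfold_locales auto
  show ?thesis
    unfolding i_embedded_def
    using H_rel_graph_usc closed_relation_H_rel entropy_H_rel_pos
      H_rel_no_periodic_point[OF assms(3,5)] by blast
qed

end
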